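(* Let $p,m\ge 1$ be integers. Suppose that indicators $Y^t=(Y_1^t,\dots,Y_p^t)'$ at times $t=0,1,2,\dots$ are related to $m$ latent factors $\eta^t=(\eta_1^t,\dots,\eta_m^t)'$ by $$Y^t=\Lambda\eta^t+\varepsilon,$$ where $\Lambda$ is a fixed $p\times m$ matrix and $\varepsilon$ is a $p\times 1$ vector of independent normally distributed random variables, and that for $t\ge 1$ $$\eta^t=B\eta^{t-1}+W^t,$$ where $B$ is a fixed $m\times m$ matrix and the $m\times 1$ random vectors $W^t$ are independently normally distributed with potentially distinct parameters at each $t$. Let $B=QDQ^{-1}$ be the Jordan decomposition of $B$, where $Q$ is an invertible $m\times m$ matrix and $D$ is an $m\times m$ matrix in Jordan normal form. Suppose that (i) as $t\to\infty$, $Y^t$ converges in distribution to some random variable $Y^*$; (ii) $B$ is invertible; (iii) the random variables $W^t$ decay sufficiently quickly that, as $t\to\infty$, $\sum_{k=1}^{t}B^{-k}W^k$ converges in distribution to some normally distributed random variable $W^*$. Then $Y^*$ follows a factor model $$Y^*=\Lambda^*\eta^*+\varepsilon$$ (for some matrix $\Lambda^*$ and some random vector of factors $\eta^*$) with $$\dim(\eta^* )=\operatorname{rank}(D^* ),\qquad\text{where } D^*=\lim_{t\to\infty}D^t .$$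
   Context: Here a prime denotes transpose. The superscript $t$ on $Y^t,\eta^t,W^t$ is a time index, while $B^t$, $D^t$, $B^{-k}$ denote matrix powers. The $(i,j)$ entry of $B$ represents the causal effect on factor $i$ at time $t$ of factor $j$ at time $t-1$. A factor model is a representation of a vector of indicators as a loading matrix times a random vector of latent factors plus the error vector $\varepsilon$; $\dim(\eta^* )$ denotes the dimensionality of the factors $\eta^*$, i.e. the number of factors in the model. The random vector $\eta^0$ is the vector of initial latent factors.
   Formalization: The existence of the limit D* = lim D^t is taken as a hypothesis, since (i)–(iii) do not imply it (e.g. m = p = 1, B = −1 with symmetric normal η^0 and W^t), and Y* = Λ*η* + ε is read as equality in distribution. *)

theory Defs
  imports "Jordan_Normal_Form.Jordan_Normal_Form" "HOL-Probability.Probability"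
begin

text \<open>Vectors and matrices in this development are those of \<open>HOL-Analysis\<close>; from
  \<open>Jordan_Normal_Form\<close> only \<open>jordan_matrix\<close> and its entries are used.\<close>

no_notation vec_index (infixl "$" 100)
no_notation scalar_prod (infix "\<bullet>" 70)
hide_const (open) Matrix.vec Matrix.mat Matrix.row Matrix.rows
  Matrix.invertible_mat Determinant.det

text \<open>The class power \<open>A ^ k\<close> on \<open>'a ^ 'n ^ 'n\<close> is componentwise, hence a separate matrix power.\<close>

primrec matpow :: "'a::semiring_1 ^ 'n ^ 'n \<Rightarrow> nat \<Rightarrow> 'a ^ 'n ^ 'n" where
  "matpow A 0 = mat 1"
| "matpow A (Suc k) = A ** matpow A k"

text \<open>Matrices indexed by a finite type carry no order of their rows, so Jordan normal form
  (upper triangular blocks along the diagonal) is relative to an enumeration of the index type.\<close>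

definition is_jordan_form :: "complex ^ 'n ^ 'n \<Rightarrow> bool" where
  "is_jordan_form D \<longleftrightarrow>
     (\<exists>(e :: 'n \<Rightarrow> nat) n_as.
        bij_betw e UNIV {..<CARD('n)} \<and>
        0 \<notin> fst ` set n_as \<and>
        sum_list (map fst n_as) = CARD('n) \<and>
        (\<forall>i j. D $ i $ j = jordan_matrix n_as $$ (e i, e j)))"

text \<open>A point mass counts as a normal distribution of variance \<open>0\<close>; without this convention, linear
  functionals of a normal vector with singular covariance matrix would not be normal.\<close>

definition (in prob_space) normal_rv :: "('a \<Rightarrow> real) \<Rightarrow> bool" where
  "normal_rv X \<longleftrightarrow>
     (\<exists>\<mu> \<sigma>. \<sigma> > 0 \<and> distributed M lborel X (normal_density \<mu> \<sigma>)) \<or>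
     (\<exists>\<mu>. random_variable borel X \<and> (AE \<omega> in M. X \<omega> = \<mu>))"

definition (in prob_space) normal_vector :: "('a \<Rightarrow> 'b::euclidean_space) \<Rightarrow> bool" where
  "normal_vector X \<longleftrightarrow>
     random_variable borel X \<and> (\<forall>u. normal_rv (\<lambda>\<omega>. u \<bullet> X \<omega>))"

text \<open>The limit variable may live on another probability space.\<close>

definition conv_in_distribution ::
    "'a measure \<Rightarrow> (nat \<Rightarrow> 'a \<Rightarrow> 'b::topological_space) \<Rightarrow> 'c measure \<Rightarrow> ('c \<Rightarrow> 'b) \<Rightarrow> bool" where
  "conv_in_distribution M X N Z \<longleftrightarrow>
     (\<forall>f :: 'b \<Rightarrow> real. continuous_on UNIV f \<longrightarrow> bounded (range f) \<longrightarrow>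
        (\<lambda>n. \<integral>\<omega>. f (X n \<omega>) \<partial>M) \<longlonglongrightarrow> (\<integral>\<omega>. f (Z \<omega>) \<partial>N))"

text \<open>\<open>Z\<close> follows a factor model with \<open>r\<close> factors and the error vector \<open>\<epsilon>\<close> given on \<open>M\<close>: it has the law
  of \<open>L *v \<eta> + \<epsilon>\<close> for a constant loading matrix \<open>L\<close> with \<open>r\<close> columns and a random vector
  \<open>\<eta>\<close> of length \<open>r\<close>. The columns are indexed by \<open>{..<r}\<close>, since \<open>r = 0\<close> must be possible.\<close>

definition follows_factor_model ::
    "'c measure \<Rightarrow> ('c \<Rightarrow> real ^ 'p) \<Rightarrow> 'a measure \<Rightarrow> ('a \<Rightarrow> real ^ 'p) \<Rightarrow> nat \<Rightarrow> bool" where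
  "follows_factor_model N Z M \<epsilon> r \<longleftrightarrow>
     (\<exists>(L :: 'p \<Rightarrow> nat \<Rightarrow> real) (\<eta> :: nat \<Rightarrow> 'a \<Rightarrow> real).
        (\<forall>j<r. \<eta> j \<in> borel_measurable M) \<and>
        distr N borel Z = distr M borel (\<lambda>\<omega>. (\<chi> i. \<Sum>j<r. L i j * \<eta> j \<omega>) + \<epsilon> \<omega>))"

end

theory Submission
  imports Defs
begin

text \<open>Unfolding the recursion gives \<open>Y\<^sup>t = \<Lambda> B\<^sup>t (\<eta>\<^sup>0 + T\<^sub>t) + \<epsilon>\<close> almost surely, where
  \<open>T\<^sub>t = \<Sum>k=1..t. B\<^bsup>-k\<^esup> W\<^sup>k\<close>. Convergence of \<open>T\<^sub>t\<close> in distribution alone says nothing about the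
  joint law with \<open>\<eta>\<^sup>0\<close> and \<open>\<epsilon>\<close>, but \<open>T\<^sub>t\<close> is a sum of independent terms: the characteristic function
  of a coordinate of \<open>T\<^sub>t - T\<^sub>s\<close> is the quotient of those of \<open>T\<^sub>t\<close> and \<open>T\<^sub>s\<close>, and tends to \<open>1\<close>
  since the limiting characteristic function, being that of a normal variable, has no zero. By Levy's
  continuity theorem \<open>T\<^sub>t\<close> is Cauchy in probability, hence converges almost surely to some \<open>T\<close> along a
  subsequence. Along it \<open>Y\<^sup>t\<close> tends to \<open>\<Lambda> B\<^sup>* (\<eta>\<^sup>0 + T) + \<epsilon>\<close>, which therefore has the law of \<open>Y\<^sup>*\<close>.
  Here \<open>B\<^sup>* = Q D\<^sup>* Q\<^sup>-\<^sup>1\<close> is real, and its rank over the reals is at most the complex rank of \<open>D\<^sup>*\<close>;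
  coordinates in an orthonormal basis of its range are the factors, padded with zeros.\<close>

section \<open>Laws and characteristic functions\<close>

text \<open>The indicator of a closed set is the pointwise limit of the bounded continuous functions
  \<open>max 0 (1 - n * infdist x C)\<close>, and the closed sets form an intersection-stable
  generator of the Borel sets.\<close>

lemma finite_measure_eqI_bounded_continuous:
  fixes M N :: "'a::metric_space measure"
  assumes "finite_measure M" "finite_measure N"
    and sets: "sets M = sets borel" "sets N = sets borel"
    and eq: "\<And>f :: 'a \<Rightarrow> real. continuous_on UNIV f \<Longrightarrow> bounded (range f) \<Longrightarrow>
               (\<integral>x. f x \<partial>M) = (\<integral>x. f x \<partial>N)"
  shows "M = N"
proof (rule measure_eqI_generator_eq[where E = "Collect closed" and \<Omega> = UNIV and A = "\<lambda>_. UNIV"])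
  interpret M: finite_measure M by fact
  interpret N: finite_measure N by fact
  have closed_eq: "emeasure M C = emeasure N C" if C: "closed C" for C
  \<comment> \<open>By convention \<open>infdist x {} = 0\<close>, so for empty \<open>C\<close> the
    approximating functions would be constantly \<open>1\<close>.\<close>
  proof (cases "C = {}")
    case False
    define f where "f n x = max 0 (1 - real n * infdist x C)" for n x
    have cont: "continuous_on UNIV (f n)" for n
      unfolding f_def by (intro continuous_intros)
    have bound: "\<bar>f n x\<bar> \<le> 1" for n x
      by (auto simp: f_def infdist_nonneg)
    have bdd: "bounded (range (f n))" for n
      using bound by (auto intro!: boundedI[where B = 1])
    have lim: "(\<lambda>n. f n x) \<longlonglongrightarrow> indicator C x" for x
    proof (cases "x \<in> C")
      case True
      then show ?thesis by (simp add: f_def)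
    next
      case x: False
      then have pos: "infdist x C > 0"
        using in_closed_iff_infdist_zero[OF C False] infdist_nonneg[of x C] by force
      then obtain k where k: "1 < real k * infdist x C"
        using reals_Archimedean3 by blast
      have "f n x = 0" if "n \<ge> k" for n
      proof -
        have "1 < real n * infdist x C"
          using k that pos by (meson less_le_trans mult_right_mono of_nat_mono less_imp_le)
        then show ?thesis by (simp add: f_def)
      qed
      then show ?thesis
        using x by (auto intro!: tendsto_eventually eventually_sequentiallyI)
    qed
    have int: "(\<lambda>n. \<integral>x. f n x \<partial>K) \<longlonglongrightarrow> measure K C"
      if K: "finite_measure K" and sK: "sets K = sets borel" for K
    proof -
      interpret K: finite_measure K by fact
      have [measurable]: "f n \<in> borel_measurable K" for n
        using borel_measurable_continuous_onI[OF cont] sK by (simp cong: measurable_cong_sets)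
      have [measurable]: "C \<in> sets K" using C sK by simp
      have "(\<lambda>n. \<integral>x. f n x \<partial>K) \<longlonglongrightarrow> (\<integral>x. indicator C x \<partial>K)"
        by (rule integral_dominated_convergence[where w = "\<lambda>_. 1"]) (use lim bound in auto)
      then show ?thesis by simp
    qed
    have "measure M C = measure N C"
      using LIMSEQ_unique[OF int[OF assms(1) sets(1)]] int[OF assms(2) sets(2)] eq[OF cont bdd]
      by simp
    then show ?thesis by (simp add: M.emeasure_eq_measure N.emeasure_eq_measure)
  qed simp
  then show "\<And>X. X \<in> Collect closed \<Longrightarrow> emeasure M X = emeasure N X" by simp
  show "Int_stable (Collect closed :: 'a set set)" by (auto simp: Int_stable_def)
  show "sets M = sigma_sets UNIV (Collect closed)" "sets N = sigma_sets UNIV (Collect closed)"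
    using sets by (simp_all add: borel_eq_closed)
  show "emeasure M UNIV \<noteq> \<infinity>"
    by (simp add: M.emeasure_eq_measure)
qed auto

text \<open>Standardising reduces the nondegenerate case to the Gaussian exponential times a phase;
  a point mass contributes only a phase. This later permits division by the limiting characteristic
  function.\<close>

lemma (in prob_space) char_normal_rv_nonzero:
  assumes "normal_rv X"
  shows "char (distr M borel X) u \<noteq> 0"
  using assms unfolding normal_rv_def
proof (elim disjE exE conjE)
  fix \<mu> \<sigma> :: real
  assume s: "\<sigma> > 0" and d: "distributed M lborel X (normal_density \<mu> \<sigma>)"
  have [measurable]: "random_variable borel X"
    using distributed_measurable[OF d] by simp
  have "distributed M lborel (\<lambda>x. (X x - \<mu>) / \<sigma>) std_normal_density"
    using d normal_standard_normal_convert[OF s] by simp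
  then have "distr M borel (\<lambda>x. (X x - \<mu>) / \<sigma>) = std_normal_distribution"
    by (simp add: distributed_def cong: distr_cong)
  then have "char (distr M borel (\<lambda>x. (X x - \<mu>) / \<sigma>)) (u * \<sigma>) \<noteq> 0"
    by (simp add: char_std_normal_distribution)
  moreover have "char (distr M borel X) u
    = iexp (u * \<mu>) * char (distr M borel (\<lambda>x. (X x - \<mu>) / \<sigma>)) (u * \<sigma>)"
  proof -
    have "iexp (u * X x) = iexp (u * \<mu>) * iexp (u * \<sigma> * ((X x - \<mu>) / \<sigma>))" for x
      using s by (simp add: field_simps flip: exp_add)
    then have "(CLINT x|M. iexp (u * X x))
        = iexp (u * \<mu>) * (CLINT x|M. iexp (u * \<sigma> * ((X x - \<mu>) / \<sigma>)))"
      by (simp only: integral_mult_right_zero)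
    then show ?thesis
      unfolding char_def by (subst (1 2) integral_distr) simp_all
  qed
  ultimately show ?thesis by simp
next
  fix \<mu> assume [measurable]: "random_variable borel X" and "AE \<omega> in M. X \<omega> = \<mu>"
  then have "(CLINT x|M. iexp (u * X x)) = (CLINT x|M. iexp (u * \<mu>))"
    by (intro integral_cong_AE) auto
  then have "char (distr M borel X) u = (CLINT x|M. iexp (u * \<mu>))"
    unfolding char_def by (subst integral_distr) simp_all
  then show ?thesis by (simp add: prob_space)
qed

text \<open>The constant \<open>1\<close> is the characteristic function of the point mass at
  \<open>0\<close>, so Levy's theorem gives weak convergence to it. Testing with the bounded
  continuous function \<open>min 1 \<bar>x\<bar>\<close> turns this into convergence to
  \<open>0\<close> in probability.\<close>

lemma (in prob_space) char_tendsto_1_imp_tendsto_0_in_prob: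
  fixes X :: "nat \<Rightarrow> 'a \<Rightarrow> real"
  assumes [measurable]: "\<And>n. random_variable borel (X n)"
    and char: "\<And>u. (\<lambda>n. char (distr M borel (X n)) u) \<longlonglongrightarrow> 1"
  shows "(\<lambda>n. expectation (\<lambda>\<omega>. min 1 \<bar>X n \<omega>\<bar>)) \<longlonglongrightarrow> 0"
proof -
  have rd: "real_distribution (distr M borel (X n))" for n
    by (rule real_distribution_distr) simp
  have rd0: "real_distribution (return borel 0)"
    by (simp add: real_distribution_def real_distribution_axioms_def prob_space_return)
  have "weak_conv_m (\<lambda>n. distr M borel (X n)) (return borel 0)"
    by (rule levy_continuity[OF rd rd0]) (use char in \<open>simp add: char_def integral_return\<close>)
  then have "(\<lambda>n. integral\<^sup>L (distr M borel (X n)) (\<lambda>x. min 1 \<bar>x\<bar>))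
      \<longlonglongrightarrow> integral\<^sup>L (return borel 0) (\<lambda>x::real. min 1 \<bar>x\<bar>)"
    by (intro weak_conv_imp_integral_bdd_continuous_conv[where B = 1] rd rd0) (auto intro!: continuous_intros)
  then show ?thesis by (simp add: integral_distr integral_return)
qed

text \<open>By independence the characteristic function of a block \<open>{s<..t}\<close> is a
  quotient of those of two partial sums. Arguing by contradiction replaces the two indices by a
  single sequence of blocks, to which the previous lemma applies.\<close>

lemma (in prob_space) indep_sums_Cauchy_in_prob:
  fixes X :: "nat \<Rightarrow> 'a \<Rightarrow> real"
  assumes indep: "indep_vars (\<lambda>_. borel) X {1..}"
    and lim: "\<And>u. (\<lambda>t. char (distr M borel (\<lambda>\<omega>. \<Sum>k=1..t. X k \<omega>)) u) \<longlonglongrightarrow> \<phi> u"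
    and nz: "\<And>u. \<phi> u \<noteq> 0" and e: "e > 0"
  shows "\<exists>N. \<forall>s\<ge>N. \<forall>t\<ge>s. expectation (\<lambda>\<omega>. min 1 \<bar>\<Sum>k\<in>{s<..t}. X k \<omega>\<bar>) < e"
proof (rule ccontr)
  assume "\<not> ?thesis"
  then have "\<forall>n. \<exists>s t. s \<ge> n \<and> t \<ge> s \<and>
      \<not> expectation (\<lambda>\<omega>. min 1 \<bar>\<Sum>k\<in>{s<..t}. X k \<omega>\<bar>) < e"
    by blast
  then obtain s t where s: "\<And>n. n \<le> s n" and t: "\<And>n. s n \<le> t n"
    and no: "\<And>n. \<not> expectation (\<lambda>\<omega>. min 1 \<bar>\<Sum>k\<in>{s n<..t n}. X k \<omega>\<bar>) < e"
    by metis
  have rv: "random_variable borel (X k)" if "k \<ge> 1" for k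
    using indep that by (auto simp: indep_vars_def)
  define c where "c A = (\<lambda>u. char (distr M borel (\<lambda>\<omega>. \<Sum>k\<in>A. X k \<omega>)) u)" for A
  have c: "c A u = (\<Prod>k\<in>A. char (distr M borel (X k)) u)" if "A \<subseteq> {1..}" for A u
    unfolding c_def using indep_vars_subset[OF indep that] by (rule char_distr_sum)
  have split: "c {1..t n} u = c {1..s n} u * c {s n<..t n} u" for n u
  proof -
    have eq: "{1..t n} = {1..s n} \<union> {s n<..t n}" using t[of n] by auto
    then have "c {1..t n} u = (\<Prod>k\<in>{1..s n} \<union> {s n<..t n}. char (distr M borel (X k)) u)"
      using c[of "{1..t n}" u] unfolding eq by (simp add: atLeastatMost_subset_iff subset_iff)
    also have "\<dots> = c {1..s n} u * c {s n<..t n} u"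
      by (subst prod.union_disjoint) (simp_all add: c subset_iff disjoint_iff)
    finally show ?thesis .
  qed
  \<comment> \<open>Since \<open>n \<le> s n \<le> t n\<close>, both ends of the offending blocks go
    to infinity and both partial sums have the limit \<open>\<phi>\<close>.\<close>
  have ls: "filterlim s sequentially sequentially" and lt: "filterlim t sequentially sequentially"
    using s order_trans[OF s t]
    by (auto intro!: filterlim_at_top_mono[OF filterlim_ident] always_eventually)
  have "(\<lambda>n. c {s n<..t n} u) \<longlonglongrightarrow> 1" for u
  proof -
    have s': "(\<lambda>n. c {1..s n} u) \<longlonglongrightarrow> \<phi> u" and t': "(\<lambda>n. c {1..t n} u) \<longlonglongrightarrow> \<phi> u"
      using filterlim_compose[OF lim ls] filterlim_compose[OF lim lt] by (simp_all add: c_def)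
    have "(\<lambda>n. c {1..t n} u / c {1..s n} u) \<longlonglongrightarrow> \<phi> u / \<phi> u"
      by (rule tendsto_divide[OF t' s' nz])
    \<comment> \<open>Cancelling needs a nonzero denominator, which
      \<open>\<phi> u \<noteq> 0\<close> guarantees only from some \<open>n\<close> on.\<close>
    moreover have "\<forall>\<^sub>F n in sequentially. c {1..t n} u / c {1..s n} u = c {s n<..t n} u"
      using tendsto_imp_eventually_ne[OF s' nz] by eventually_elim (simp only: split, simp)
    ultimately show ?thesis using nz by (simp add: tendsto_cong)
  qed
  then have "(\<lambda>n. expectation (\<lambda>\<omega>. min 1 \<bar>\<Sum>k\<in>{s n<..t n}. X k \<omega>\<bar>)) \<longlonglongrightarrow> 0"
    by (intro char_tendsto_1_imp_tendsto_0_in_prob) (auto simp: c_def intro!: borel_measurable_sum rv)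
  then have "\<forall>\<^sub>F n in sequentially. expectation (\<lambda>\<omega>. min 1 \<bar>\<Sum>k\<in>{s n<..t n}. X k \<omega>\<bar>) < e"
    using e by (rule order_tendstoD)
  then show False using no by (auto simp: eventually_sequentially)
qed

section \<open>Truncated distances and almost surely convergent subsequences\<close>

lemma borel_measurable_vec_iff:
  "f \<in> borel_measurable M \<longleftrightarrow> (\<forall>i. (\<lambda>x. f x $ i) \<in> borel_measurable M)" for f :: "'a \<Rightarrow> real ^ 'n"
  by (subst borel_measurable_euclidean_space) (auto simp: Basis_vec_def inner_axis)

text \<open>If one coordinate reaches \<open>1\<close>, the right side does too; otherwise no
  truncation is active and this is the bound of the norm by the sum of absolute values.\<close>

lemma min_1_norm_le_sum_min_1_abs: "min 1 (norm x) \<le> (\<Sum>i\<in>UNIV. min 1 \<bar>x $ i\<bar>)" for x :: "real ^ 'n"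
proof (cases "\<exists>i. \<bar>x $ i\<bar> \<ge> 1")
  case True
  then obtain i where "\<bar>x $ i\<bar> \<ge> 1" by blast
  then have "1 \<le> (\<Sum>i\<in>UNIV. min 1 \<bar>x $ i\<bar>)"
    using member_le_sum[of i UNIV "\<lambda>i. min 1 \<bar>x $ i\<bar>"] by simp
  then show ?thesis by simp
next
  case False
  then have "(\<Sum>i\<in>UNIV. min 1 \<bar>x $ i\<bar>) = (\<Sum>i\<in>UNIV. \<bar>x $ i\<bar>)"
    by (intro sum.cong) (auto simp: not_le intro!: min_absorb2 less_imp_le)
  then show ?thesis using norm_le_l1_cart[of x] by simp
qed

lemma summable_of_summable_min_1:
  fixes f :: "nat \<Rightarrow> real"
  assumes "summable (\<lambda>n. min 1 (f n))"
  shows "summable f"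
proof -
  have "\<forall>\<^sub>F n in sequentially. min 1 (f n) < 1"
    using summable_LIMSEQ_zero[OF assms] by (rule order_tendstoD) simp
  then have "\<forall>\<^sub>F n in sequentially. min 1 (f n) = f n"
    by eventually_elim auto
  then show ?thesis using assms summable_cong by fast
qed

text \<open>Along a fast subsequence the expected truncated increments are below a geometric series.
  Hence the increments are almost surely summable, and completeness gives a limit.\<close>

lemma (in prob_space) Cauchy_in_prob_imp_AE_convergent_subseq:
  fixes T :: "nat \<Rightarrow> 'a \<Rightarrow> 'b::{banach, second_countable_topology}"
  assumes [measurable]: "\<And>t. random_variable borel (T t)"
    and cauchy: "\<And>e. e > 0 \<Longrightarrow> \<exists>N. \<forall>s\<ge>N. \<forall>t\<ge>s. expectation (\<lambda>\<omega>. min 1 (norm (T t \<omega> - T s \<omega>))) < e"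
  shows "\<exists>r. strict_mono r \<and> (AE \<omega> in M. convergent (\<lambda>n. T (r n) \<omega>))"
proof -
  have "\<exists>N. \<forall>n. \<forall>s\<ge>N n. \<forall>t\<ge>s. expectation (\<lambda>\<omega>. min 1 (norm (T t \<omega> - T s \<omega>))) < (1/2)^n"
    using cauchy[of "(1/2)^n" for n] by (intro choice) auto
  then obtain N where N: "\<And>n s t. s \<ge> N n \<Longrightarrow> t \<ge> s \<Longrightarrow>
      expectation (\<lambda>\<omega>. min 1 (norm (T t \<omega> - T s \<omega>))) < (1/2)^n"
    by blast
  \<comment> \<open>Each partial sum dominates its last term \<open>N n\<close>, and
    \<open>Suc\<close> makes the sums strictly increasing.\<close>
  define r where "r n = (\<Sum>k\<le>n. Suc (N k))" for n
  have r: "strict_mono r" "N n \<le> r n" for n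
    by (auto simp: r_def strict_mono_Suc_iff intro: order_trans[OF _ member_le_sum[of n]])
  define d where "d n \<omega> = norm (T (r (Suc n)) \<omega> - T (r n) \<omega>)" for n \<omega>
  have [measurable]: "random_variable borel (d n)" for n
    unfolding d_def by measurable
  have int: "integrable M (\<lambda>\<omega>. min 1 (d n \<omega>))" for n
    by (rule integrable_const_bound[where B = 1]) (auto simp: d_def)
  have E: "expectation (\<lambda>\<omega>. min 1 (d n \<omega>)) \<le> (1/2)^n" for n
    using N[OF r(2)[of n], of "r (Suc n)"] r(1) by (auto simp: d_def strict_mono_less_eq less_imp_le)
  \<comment> \<open>In \<open>ennreal\<close>, sum and integral interchange without any summability
    condition; finiteness of the integral then gives almost sure finiteness of the sum.\<close>
  have "(\<integral>\<^sup>+\<omega>. (\<Sum>n. ennreal (min 1 (d n \<omega>))) \<partial>M) = (\<Sum>n. \<integral>\<^sup>+\<omega>. ennreal (min 1 (d n \<omega>)) \<partial>M)"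
    by (rule nn_integral_suminf) simp
  also have "\<dots> \<le> (\<Sum>n. ennreal ((1/2)^n))"
    by (intro suminf_le summableI, subst nn_integral_eq_integral[OF int])
      (auto simp: d_def[abs_def] intro!: ennreal_leI E[unfolded d_def])
  also have "\<dots> < \<infinity>"
    by (subst suminf_ennreal2) (auto simp: summable_geometric)
  finally have "AE \<omega> in M. (\<Sum>n. ennreal (min 1 (d n \<omega>))) \<noteq> \<infinity>"
    by (intro nn_integral_PInf_AE) auto
  then have "AE \<omega> in M. convergent (\<lambda>n. T (r n) \<omega>)"
  proof eventually_elim
    case (elim \<omega>)
    then have "summable (\<lambda>n. min 1 (d n \<omega>))"
      by (intro summable_suminf_not_top) (auto simp: d_def)
    then have "summable (\<lambda>n. norm (T (r (Suc n)) \<omega> - T (r n) \<omega>))"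
      unfolding d_def by (rule summable_of_summable_min_1)
    then have "summable (\<lambda>n. T (r (Suc n)) \<omega> - T (r n) \<omega>)"
      by (rule summable_norm_cancel)
    then have "convergent (\<lambda>n. \<Sum>k<n. T (r (Suc k)) \<omega> - T (r k) \<omega>)"
      by (simp add: summable_iff_convergent)
    then have "convergent (\<lambda>n. T (r n) \<omega> - T (r 0) \<omega>)"
      by (simp only: sum_lessThan_telescope[of "\<lambda>n. T (r n) \<omega>"])
    then have "convergent (\<lambda>n. T (r n) \<omega> - T (r 0) \<omega> + T (r 0) \<omega>)"
      by (intro convergent_add convergent_const)
    then show ?case by simp
  qed
  with r(1) show ?thesis by blast
qed

section \<open>Rank and matrix powers\<close>

lemma linear_vector_matrix_mult: "Vector_Spaces.linear (*s) (*s) (\<lambda>v. v v* A)"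
  for A :: "'a::field ^ 'n ^ 'm"
proof -
  have "(\<lambda>v. v v* A) = (*v) (transpose A)" by (simp add: fun_eq_iff)
  then show ?thesis by (simp only: matrix_vector_mul_linear_gen)
qed

text \<open>Unit vectors \<open>axis i 1\<close> produce the rows, and \<open>v v* A\<close>
  combines the rows with coefficients \<open>v\<close>. Rank thus becomes the dimension of an image,
  over any field, and products become compositions.\<close>

lemma span_rows_eq_range: "vec.span (rows A) = range (\<lambda>v. v v* A)" for A :: "'a::field ^ 'n ^ 'm"
proof
  have lin: "Vector_Spaces.linear (*s) (*s) (\<lambda>v. v v* A)"
    by (rule linear_vector_matrix_mult)
  have "row i A = axis i 1 v* A" for i
    by (simp add: vec_eq_iff row_def vector_matrix_mult_def axis_def if_distribR
        if_distrib[where f = "\<lambda>x. x * _"] cong: if_cong)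
  then have "rows A \<subseteq> range (\<lambda>v. v v* A)"
    by (auto simp: rows_def)
  moreover have "vec.subspace (range (\<lambda>v. v v* A))"
    using lin vec.subspace_UNIV by (rule vec.linear_subspace_image)
  ultimately show "vec.span (rows A) \<subseteq> range (\<lambda>v. v v* A)"
    by (rule vec.span_minimal)
  have "v v* A = (\<Sum>i\<in>UNIV. v $ i *s row i A)" for v
    by (simp add: vec_eq_iff row_def vector_matrix_mult_def)
  then show "range (\<lambda>v. v v* A) \<subseteq> vec.span (rows A)"
    by (force simp: rows_def intro!: vec.span_sum vec.span_scale intro: vec.span_base)
qed

lemma rank_eq_dim_range_left: "rank A = vec.dim (range (\<lambda>v. v v* A))" for A :: "'a::field ^ 'n ^ 'm"
  by (simp add: row_rank_def_gen flip: span_rows_eq_range)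

lemma rank_mult_le_right: "rank (A ** B) \<le> rank B"
  for A :: "'a::field ^ 'n ^ 'm" and B :: "'a ^ 'k ^ 'n"
proof -
  have "range (\<lambda>v. v v* (A ** B)) \<subseteq> range (\<lambda>v. v v* B)"
    by (auto simp flip: vector_matrix_mul_assoc)
  then show ?thesis
    unfolding rank_eq_dim_range_left by (rule vec.dim_subset)
qed

lemma rank_mult_le_left: "rank (A ** B) \<le> rank A"
  for A :: "'a::field ^ 'n ^ 'm" and B :: "'a ^ 'k ^ 'n"
proof -
  have lin: "Vector_Spaces.linear (*s) (*s) (\<lambda>v. v v* B)"
    by (rule linear_vector_matrix_mult)
  have "range (\<lambda>v. v v* (A ** B)) = (\<lambda>v. v v* B) ` range (\<lambda>v. v v* A)"
    by (simp add: image_image vector_matrix_mul_assoc)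
  then show ?thesis
    unfolding rank_eq_dim_range_left using vec.dim_image_le[OF lin] by metis
qed

section \<open>Real vectors and matrices over the complex numbers\<close>

definition complex_vec :: "real ^ 'n \<Rightarrow> complex ^ 'n" where
  "complex_vec x = (\<chi> j. complex_of_real (x $ j))"

definition complex_mat :: "real ^ 'n ^ 'm \<Rightarrow> complex ^ 'n ^ 'm" where
  "complex_mat A = (\<chi> i j. complex_of_real (A $ i $ j))"

lemma inj_complex_vec: "inj complex_vec"
  by (auto simp: inj_def complex_vec_def vec_eq_iff)

text \<open>The vectors have real coordinates, so a vanishing complex combination splits into two
  vanishing real ones, with the real and the imaginary parts as coefficients.\<close>

lemma complex_vec_independent:
  assumes S: "independent S"
  shows "vec.independent (complex_vec ` S)"
proof -
  have fin: "finite S" using S by (rule independent_imp_finite)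
  have inj: "inj_on complex_vec S" using inj_complex_vec by (rule inj_on_subset) simp
  show ?thesis
  proof (rule vec.independent_if_scalars_zero)
    show "finite (complex_vec ` S)" using fin by simp
    fix f y assume 0: "(\<Sum>z\<in>complex_vec ` S. f z *s z) = 0" and "y \<in> complex_vec ` S"
    then obtain x where x: "x \<in> S" "y = complex_vec x" by blast
    have *: "(\<Sum>z\<in>S. f (complex_vec z) * complex_of_real (z $ j)) = 0" for j
      using arg_cong[OF 0, of "\<lambda>v. v $ j"] inj by (simp add: sum.reindex) (simp add: complex_vec_def)
    have sums: "(\<Sum>z\<in>S. Re (f (complex_vec z)) *\<^sub>R z) = 0" "(\<Sum>z\<in>S. Im (f (complex_vec z)) *\<^sub>R z) = 0"
      using arg_cong[OF *, of Re] arg_cong[OF *, of Im] by (auto simp: vec_eq_iff)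
    have "Re (f y) = 0" "Im (f y) = 0"
      using independentD[OF S fin subset_refl sums(1) x(1)]
        independentD[OF S fin subset_refl sums(2) x(1)] x(2) by simp_all
    then show "f y = 0" by (simp add: complex_eq_iff)
  qed
qed

text \<open>A real basis of the row space chosen among the rows remains independent after
  complexification.\<close>

lemma rank_le_rank_complex_mat: "rank A \<le> rank (complex_mat A)"
proof -
  obtain S where S: "S \<subseteq> rows A" "independent S" "card S = dim (rows A)"
    using basis_exists by metis
  have "complex_vec ` S \<subseteq> rows (complex_mat A)"
    using S(1) by (auto simp: rows_def row_def complex_vec_def complex_mat_def)
  then have "card (complex_vec ` S) \<le> vec.dim (rows (complex_mat A))"
    using complex_vec_independent[OF S(2)] by (intro vec.independent_card_le_dim)
  then show ?thesis
    using S(3) by (simp add: card_image inj_on_subset[OF inj_complex_vec] row_rank_def)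
       (simp add: row_rank_def_gen)
qed

section \<open>Matrix powers, their limits and a factorisation by rank\<close>

lemma matrix_inv:
  assumes "invertible A"
  shows "A ** matrix_inv A = mat 1" "matrix_inv A ** A = mat 1"
  using someI_ex[OF assms[unfolded invertible_def]] by (simp_all add: matrix_inv_def)

lemma matpow_conjugate: "invertible Q \<Longrightarrow> matpow (Q ** D ** matrix_inv Q) t = Q ** matpow D t ** matrix_inv Q"
proof (induction t)
  case (Suc t)
  then have "Q ** D ** matrix_inv Q ** (Q ** matpow D t ** matrix_inv Q)
    = Q ** D ** (matrix_inv Q ** Q) ** matpow D t ** matrix_inv Q"
    by (simp only: matrix_mul_assoc)
  then show ?case using Suc by (simp add: matrix_inv matrix_mul_assoc)
qed (simp add: matrix_inv)

lemma matpow_Suc_right: "matpow A (Suc t) = matpow A t ** A"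
  by (induction t) (simp_all add: matrix_mul_assoc)

text \<open>Peeling \<open>A\<close> off the right of one power and its inverse off the left of the
  other makes them meet and cancel in the middle.\<close>

lemma matpow_matrix_inv: "invertible A \<Longrightarrow> matpow A t ** matpow (matrix_inv A) t = mat 1"
proof (induction t)
  case (Suc t)
  have "matpow A (Suc t) ** matpow (matrix_inv A) (Suc t)
    = matpow A t ** (A ** matrix_inv A) ** matpow (matrix_inv A) t"
    unfolding matpow_Suc_right[of A] by (simp add: matrix_mul_assoc)
  then show ?case using Suc by (simp add: matrix_inv)
qed simp

lemma matpow_complex_mat: "matpow (complex_mat A) t = complex_mat (matpow A t)"
proof (induction t)
  case 0
  then show ?case by (simp add: complex_mat_def mat_def vec_eq_iff)
next
  case (Suc t)
  then show ?case by (simp add: complex_mat_def matrix_matrix_mult_def vec_eq_iff)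
qed

lemma tendsto_matrix_mult:
  fixes f :: "'c \<Rightarrow> 'a::real_normed_algebra_1 ^ 'n ^ 'm" and g :: "'c \<Rightarrow> 'a ^ 'k ^ 'n"
  assumes "(f \<longlongrightarrow> A) F" and "(g \<longlongrightarrow> B) F"
  shows "((\<lambda>x. f x ** g x) \<longlongrightarrow> A ** B) F"
  unfolding matrix_matrix_mult_def by (intro tendsto_intros assms)

lemma tendsto_matrix_vector_mult:
  fixes f :: "'c \<Rightarrow> 'a::real_normed_algebra_1 ^ 'n ^ 'm" and g :: "'c \<Rightarrow> 'a ^ 'n"
  assumes "(f \<longlongrightarrow> A) F" and "(g \<longlongrightarrow> x) F"
  shows "((\<lambda>x. f x *v g x) \<longlongrightarrow> A *v x) F"
  unfolding matrix_vector_mult_def by (intro tendsto_intros assms)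

text \<open>Conjugation by \<open>Q\<close> carries the limit of the powers of \<open>D\<close> to
  that of the powers of \<open>B\<close>. Multiplication by further matrices does not raise the
  rank, and neither does the descent to the reals.\<close>

lemma matpow_limit_real:
  fixes B :: "real ^ 'm ^ 'm" and Q D Dstar :: "complex ^ 'm ^ 'm"
  assumes Q: "invertible Q" and B: "complex_mat B = Q ** D ** matrix_inv Q"
    and lim: "(\<lambda>t. matpow D t) \<longlonglongrightarrow> Dstar"
  obtains Bstar where "(\<lambda>t. matpow B t) \<longlonglongrightarrow> Bstar" "rank Bstar \<le> rank Dstar"
proof
  let ?C = "Q ** Dstar ** matrix_inv Q"
  define Bstar where "Bstar = (\<chi> i j. Re (?C $ i $ j))"
  have "(\<lambda>t. Q ** matpow D t ** matrix_inv Q) \<longlonglongrightarrow> ?C"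
    by (intro tendsto_matrix_mult tendsto_const lim)
  then have C: "(\<lambda>t. complex_mat (matpow B t)) \<longlonglongrightarrow> ?C"
    by (simp add: B matpow_conjugate[OF Q] flip: matpow_complex_mat)
  then have C': "(\<lambda>t. complex_of_real (matpow B t $ i $ j)) \<longlonglongrightarrow> ?C $ i $ j" for i j
    using tendsto_vec_nth[OF tendsto_vec_nth[OF C, of i], of j] by (simp add: complex_mat_def)
  then have "(\<lambda>t. \<chi> i j. matpow B t $ i $ j) \<longlonglongrightarrow> Bstar"
    unfolding Bstar_def using tendsto_Re by (intro tendsto_vec_lambda) fastforce
  then show "(\<lambda>t. matpow B t) \<longlonglongrightarrow> Bstar" by simp
  \<comment> \<open>Each entry of \<open>?C\<close> is a limit of real numbers, so taking real parts
    in \<open>Bstar\<close> lost nothing.\<close>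
  have "Im (?C $ i $ j) = 0" for i j
    using LIMSEQ_unique[OF tendsto_Im[OF C', of i j]] by simp
  then have "complex_mat Bstar = ?C"
    by (simp add: complex_mat_def Bstar_def vec_eq_iff complex_eq_iff)
  then show "rank Bstar \<le> rank Dstar"
    using rank_le_rank_complex_mat[of Bstar] rank_mult_le_left[of "Q ** Dstar" "matrix_inv Q"]
      rank_mult_le_right[of Q Dstar] by simp
qed

text \<open>The \<open>b j\<close> are an orthonormal basis of the range, padded with zeros up to
  \<open>r\<close>. The coefficient of \<open>A *v x\<close> along \<open>b j\<close> is linear in
  \<open>x\<close>: moving \<open>A\<close> to the other side of the inner product gives
  \<open>c j = b j v* A\<close>.\<close>

lemma rank_factorisation:
  fixes A :: "real ^ 'n ^ 'm"
  assumes "rank A \<le> r"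
  obtains b c where "\<And>x. A *v x = (\<Sum>j<r. (c j \<bullet> x) *\<^sub>R b j)"
proof -
  have "subspace (range ((*v) A))"
    by (intro linear_subspace_image subspace_UNIV matrix_vector_mul_linear)
  then obtain S where S: "pairwise orthogonal S" "\<And>x. x \<in> S \<Longrightarrow> norm x = 1"
    "independent S" "card S = dim (range ((*v) A))" "span S = range ((*v) A)"
    by (metis orthonormal_basis_subspace)
  have fin: "finite S" using S(3) by (rule independent_imp_finite)
  have cS: "card S \<le> r" using S(4) assms by (simp add: rank_dim_range)
  obtain h where h: "bij_betw h {..<card S} S"
    using ex_bij_betw_nat_finite[OF fin] by (auto simp: atLeast0LessThan)
  define b where "b j = (if j < card S then h j else 0)" for j
  have "A *v x = (\<Sum>j<r. ((b j v* A) \<bullet> x) *\<^sub>R b j)" for x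
  proof -
    have "A *v x = (\<Sum>v\<in>S. ((A *v x) \<bullet> v) *\<^sub>R v)"
      using S fin by (intro orthonormal_basis_expand[symmetric]) auto
    also have "\<dots> = (\<Sum>j<card S. ((A *v x) \<bullet> b j) *\<^sub>R b j)"
      by (subst sum.reindex_bij_betw[OF h, symmetric]) (simp add: b_def)
    also have "\<dots> = (\<Sum>j<r. ((A *v x) \<bullet> b j) *\<^sub>R b j)"
      using cS by (intro sum.mono_neutral_left) (auto simp: b_def)
    finally show ?thesis by (simp add: dot_lmul_matrix) (simp add: inner_commute)
  qed
  then show thesis by (rule that)
qed

section \<open>Limits of independent sums\<close>

text \<open>Cosine and sine of \<open>u\<close> times a coordinate are bounded continuous test
  functions; their integrals are the real and imaginary parts of the characteristic
  function.\<close>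

lemma (in prob_space) conv_in_distribution_imp_char_nth_tendsto:
  fixes T :: "nat \<Rightarrow> 'a \<Rightarrow> real ^ 'm" and Z :: "'c \<Rightarrow> real ^ 'm"
  assumes [measurable]: "\<And>t. random_variable borel (T t)"
    and N: "prob_space N" and [measurable]: "Z \<in> borel_measurable N"
    and conv: "conv_in_distribution M T N Z"
  shows "(\<lambda>t. char (distr M borel (\<lambda>\<omega>. T t \<omega> $ i)) u) \<longlonglongrightarrow> char (distr N borel (\<lambda>\<omega>. Z \<omega> $ i)) u"
proof -
  interpret N: prob_space N by fact
  \<comment> \<open>Stated for an arbitrary probability space, because it is applied both to
    \<open>M\<close> and to the space \<open>N\<close> of the limit.\<close>
  have char_eq: "char (distr K borel (\<lambda>\<omega>. X \<omega> $ i)) u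
      = Complex (\<integral>\<omega>. cos (u * X \<omega> $ i) \<partial>K) (\<integral>\<omega>. sin (u * X \<omega> $ i) \<partial>K)"
    if "prob_space K" and [measurable]: "X \<in> borel_measurable K"
    for K :: "'k measure" and X :: "'k \<Rightarrow> real ^ 'm"
  proof -
    interpret K: prob_space K by fact
    have [measurable]: "(\<lambda>\<omega>. X \<omega> $ i) \<in> borel_measurable K"
      using borel_measurable_vec_iff that(2) by blast
    have int: "integrable K (\<lambda>\<omega>. iexp (u * X \<omega> $ i))"
      by (rule K.integrable_iexp) simp_all
    have "Re (CLINT \<omega>|K. iexp (u * X \<omega> $ i)) = (\<integral>\<omega>. Re (iexp (u * X \<omega> $ i)) \<partial>K)"
      "Im (CLINT \<omega>|K. iexp (u * X \<omega> $ i)) = (\<integral>\<omega>. Im (iexp (u * X \<omega> $ i)) \<partial>K)"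
      by (simp_all only: integral_Re[OF int] integral_Im[OF int])
    then have "Re (CLINT \<omega>|K. iexp (u * X \<omega> $ i)) = (\<integral>\<omega>. cos (u * X \<omega> $ i) \<partial>K)"
      "Im (CLINT \<omega>|K. iexp (u * X \<omega> $ i)) = (\<integral>\<omega>. sin (u * X \<omega> $ i) \<partial>K)"
      unfolding Re_exp Im_exp by simp_all
    then show ?thesis
      unfolding char_def by (subst integral_distr) (simp_all add: complex_eq_iff)
  qed
  have "(\<lambda>t. \<integral>\<omega>. cos (u * T t \<omega> $ i) \<partial>M) \<longlonglongrightarrow> (\<integral>\<omega>. cos (u * Z \<omega> $ i) \<partial>N)"
    by (rule conv[unfolded conv_in_distribution_def, rule_format, of "\<lambda>x. cos (u * x $ i)"])
       (auto intro!: continuous_intros boundedI[where B = 1])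
  moreover have "(\<lambda>t. \<integral>\<omega>. sin (u * T t \<omega> $ i) \<partial>M) \<longlonglongrightarrow> (\<integral>\<omega>. sin (u * Z \<omega> $ i) \<partial>N)"
    by (rule conv[unfolded conv_in_distribution_def, rule_format, of "\<lambda>x. sin (u * x $ i)"])
       (auto intro!: continuous_intros boundedI[where B = 1])
  ultimately show ?thesis
    by (simp add: char_eq prob_space_axioms N tendsto_Complex)
qed

text \<open>The scalar Cauchy criterion is applied to each coordinate, and the finitely many
  coordinates are recombined through \<open>min_1_norm_le_sum_min_1_abs\<close>.\<close>

lemma (in prob_space) indep_sums_AE_convergent_subseq:
  fixes X :: "nat \<Rightarrow> 'a \<Rightarrow> real ^ 'm" and Z :: "'c \<Rightarrow> real ^ 'm"
  assumes indep: "indep_vars (\<lambda>_. borel) X {1..}"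
    and N: "prob_space N" and Z: "prob_space.normal_vector N Z"
    and conv: "conv_in_distribution M (\<lambda>t \<omega>. \<Sum>k=1..t. X k \<omega>) N Z"
  shows "\<exists>r. strict_mono r \<and> (AE \<omega> in M. convergent (\<lambda>n. \<Sum>k=1..r n. X k \<omega>))"
proof (rule Cauchy_in_prob_imp_AE_convergent_subseq)
  interpret N: prob_space N by fact
  have rv: "random_variable borel (X k)" if "k \<ge> 1" for k
    using indep that by (auto simp: indep_vars_def)
  have T: "random_variable borel (\<lambda>\<omega>. \<Sum>k\<in>A. X k \<omega>)" if "A \<subseteq> {1..}" for A
    using that by (intro borel_measurable_sum rv) auto
  show "random_variable borel (\<lambda>\<omega>. \<Sum>k=1..t. X k \<omega>)" for t
    by (rule T) auto
  fix e :: real assume e: "e > 0"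
  \<comment> \<open>The estimates of the \<open>CARD('m)\<close> coordinates will add up to
    \<open>e\<close>.\<close>
  define \<delta> where "\<delta> = e / CARD('m)"
  have \<delta>: "\<delta> > 0" using e by (simp add: \<delta>_def)
  have "\<exists>K. \<forall>s\<ge>K. \<forall>t\<ge>s. expectation (\<lambda>\<omega>. min 1 \<bar>\<Sum>k\<in>{s<..t}. X k \<omega> $ i\<bar>) < \<delta>" for i
  proof (rule indep_sums_Cauchy_in_prob[OF _ _ _ \<delta>])
    show "indep_vars (\<lambda>_. borel) (\<lambda>k \<omega>. X k \<omega> $ i) {1..}"
      using indep by (rule indep_vars_compose2) simp
    have "(\<lambda>t. char (distr M borel (\<lambda>\<omega>. (\<Sum>k=1..t. X k \<omega>) $ i)) u)
        \<longlonglongrightarrow> char (distr N borel (\<lambda>\<omega>. Z \<omega> $ i)) u" for u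
      using Z by (intro conv_in_distribution_imp_char_nth_tendsto[OF _ N _ conv] T)
        (auto simp: N.normal_vector_def)
    then show "(\<lambda>t. char (distr M borel (\<lambda>\<omega>. \<Sum>k=1..t. X k \<omega> $ i)) u)
        \<longlonglongrightarrow> char (distr N borel (\<lambda>\<omega>. Z \<omega> $ i)) u" for u
      by simp
    \<comment> \<open>A coordinate is the linear functional given by \<open>axis i 1\<close>, hence
      normal, possibly degenerate.\<close>
    have "N.normal_rv (\<lambda>\<omega>. axis i 1 \<bullet> Z \<omega>)"
      using Z by (simp add: N.normal_vector_def)
    then show "char (distr N borel (\<lambda>\<omega>. Z \<omega> $ i)) u \<noteq> 0" for u
      by (intro N.char_normal_rv_nonzero) (simp add: inner_axis')
  qed
  then obtain K where K: "\<And>i s t. s \<ge> K i \<Longrightarrow> t \<ge> s \<Longrightarrow>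
      expectation (\<lambda>\<omega>. min 1 \<bar>\<Sum>k\<in>{s<..t}. X k \<omega> $ i\<bar>) < \<delta>"
    by metis
  show "\<exists>N. \<forall>s\<ge>N. \<forall>t\<ge>s.
      expectation (\<lambda>\<omega>. min 1 (norm ((\<Sum>k=1..t. X k \<omega>) - (\<Sum>k=1..s. X k \<omega>)))) < e"
  proof (intro exI allI impI)
    \<comment> \<open>The index type is finite, so the maximum of the thresholds \<open>K i\<close>
      serves all coordinates.\<close>
    fix s t assume s: "Max (range K) \<le> s" and t: "s \<le> t"
    have Ks: "K i \<le> s" for i
      using s by (rule order_trans[rotated]) simp
    have [measurable]: "random_variable borel (\<lambda>\<omega>. \<Sum>k\<in>{s<..t}. X k \<omega>)"
      by (rule T) auto
    have [measurable]: "random_variable borel (\<lambda>\<omega>. \<Sum>k\<in>{s<..t}. X k \<omega> $ i)" for i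
      using T[of "{s<..t}"] by (fastforce simp: borel_measurable_vec_iff)
    have "{1..t} - {1..s} = {s<..t}" using t by auto
    then have diff: "(\<Sum>k=1..t. X k \<omega>) - (\<Sum>k=1..s. X k \<omega>) = (\<Sum>k\<in>{s<..t}. X k \<omega>)" for \<omega>
      using t by (subst sum_diff[symmetric]) auto
    have "expectation (\<lambda>\<omega>. min 1 (norm (\<Sum>k\<in>{s<..t}. X k \<omega>)))
        \<le> expectation (\<lambda>\<omega>. \<Sum>i\<in>UNIV. min 1 \<bar>\<Sum>k\<in>{s<..t}. X k \<omega> $ i\<bar>)"
    proof (rule integral_mono)
      show "min 1 (norm (\<Sum>k\<in>{s<..t}. X k \<omega>)) \<le> (\<Sum>i\<in>UNIV. min 1 \<bar>\<Sum>k\<in>{s<..t}. X k \<omega> $ i\<bar>)" for \<omega>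
        using min_1_norm_le_sum_min_1_abs[of "\<Sum>k\<in>{s<..t}. X k \<omega>"] by simp
    qed (auto intro!: integrable_const_bound[where B = 1] Bochner_Integration.integrable_sum)
    also have "\<dots> = (\<Sum>i\<in>UNIV. expectation (\<lambda>\<omega>. min 1 \<bar>\<Sum>k\<in>{s<..t}. X k \<omega> $ i\<bar>))"
      by (rule Bochner_Integration.integral_sum) (auto intro!: integrable_const_bound[where B = 1])
    also have "\<dots> < (\<Sum>i\<in>(UNIV :: 'm set). \<delta>)"
      by (rule sum_strict_mono) (use K[OF Ks t] in auto)
    also have "\<dots> = e" by (simp add: \<delta>_def)
    finally show "expectation (\<lambda>\<omega>. min 1 (norm ((\<Sum>k=1..t. X k \<omega>) - (\<Sum>k=1..s. X k \<omega>)))) < e"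
      by (simp only: diff)
  qed
qed

text \<open>For each bounded continuous \<open>f\<close>, dominated convergence along the
  subsequence and convergence in distribution give two limits of the same integrals, which must
  agree; such integrals determine the law.\<close>

lemma conv_in_distribution_AE_subseq_limit:
  fixes X :: "nat \<Rightarrow> 'a \<Rightarrow> 'b::metric_space"
  assumes M: "prob_space M" and N: "prob_space N"
    and [measurable]: "\<And>n. X n \<in> borel_measurable M" "Z \<in> borel_measurable N"
      "Z' \<in> borel_measurable M"
    and conv: "conv_in_distribution M X N Z"
    and r: "strict_mono r" and AE: "AE \<omega> in M. (\<lambda>n. X (r n) \<omega>) \<longlonglongrightarrow> Z' \<omega>"
  shows "distr N borel Z = distr M borel Z'"
proof (rule finite_measure_eqI_bounded_continuous)
  interpret M: prob_space M by fact
  interpret N: prob_space N by fact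
  show "finite_measure (distr N borel Z)" "finite_measure (distr M borel Z')"
    by (intro M.finite_measure_distr N.finite_measure_distr; simp)+
  fix f :: "'b \<Rightarrow> real" assume f: "continuous_on UNIV f" "bounded (range f)"
  have [measurable]: "f \<in> borel_measurable borel"
    using f(1) by (rule borel_measurable_continuous_onI)
  obtain C where C: "\<And>x. norm (f x) \<le> C"
    using f(2) by (auto simp: bounded_iff)
  have "(\<lambda>n. \<integral>\<omega>. f (X (r n) \<omega>) \<partial>M) \<longlonglongrightarrow> (\<integral>\<omega>. f (Z' \<omega>) \<partial>M)"
  proof (rule integral_dominated_convergence[where w = "\<lambda>_. C"])
    show "AE \<omega> in M. (\<lambda>n. f (X (r n) \<omega>)) \<longlonglongrightarrow> f (Z' \<omega>)"
      using AE by eventually_elim (rule continuous_on_tendsto_compose[OF f(1)], auto)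
  qed (use C in auto)
  moreover have "(\<lambda>n. \<integral>\<omega>. f (X (r n) \<omega>) \<partial>M) \<longlonglongrightarrow> (\<integral>\<omega>. f (Z \<omega>) \<partial>N)"
    using LIMSEQ_subseq_LIMSEQ[OF _ r] conv f by (fastforce simp: conv_in_distribution_def comp_def)
  ultimately have "(\<integral>\<omega>. f (Z' \<omega>) \<partial>M) = (\<integral>\<omega>. f (Z \<omega>) \<partial>N)"
    by (rule LIMSEQ_unique)
  then show "(\<integral>x. f x \<partial>distr N borel Z) = (\<integral>x. f x \<partial>distr M borel Z')"
    by (simp add: integral_distr)
qed auto

lemma autoregression_unfold:
  fixes x w :: "nat \<Rightarrow> real ^ 'm"
  assumes B: "invertible B" and rec: "\<And>t. t \<ge> 1 \<Longrightarrow> x t = B *v x (t - 1) + w t"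
  shows "x t = matpow B t *v (x 0 + (\<Sum>k=1..t. matpow (matrix_inv B) k *v w k))"
proof (induction t)
  case (Suc t)
  let ?S = "\<Sum>k=1..t. matpow (matrix_inv B) k *v w k"
  \<comment> \<open>Writing the new noise as a power of \<open>B\<close> times the next summand lets
    that power be factored out of the whole state.\<close>
  have "w (Suc t) = matpow B (Suc t) *v (matpow (matrix_inv B) (Suc t) *v w (Suc t))"
    by (simp only: matrix_vector_mul_assoc matpow_matrix_inv[OF B] matrix_vector_mul_lid)
  moreover have "B *v x t = matpow B (Suc t) *v (x 0 + ?S)"
    by (simp add: Suc matrix_vector_mul_assoc)
  ultimately have "x (Suc t) = matpow B (Suc t) *v (x 0 + ?S)
      + matpow B (Suc t) *v (matpow (matrix_inv B) (Suc t) *v w (Suc t))"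
    using rec[of "Suc t"] by simp
  then show ?case
    by (simp add: matrix_vector_right_distrib add.assoc del: matpow.simps)
qed simp

lemma borel_measurable_matrix_vector_mult [measurable (raw)]:
  "f \<in> borel_measurable M \<Longrightarrow> (\<lambda>x. A *v f x) \<in> borel_measurable M" for A :: "real ^ 'n ^ 'm"
  by (rule borel_measurable_continuous_on[OF matrix_vector_mult_linear_continuous_on])

theorem theorem1:
  fixes M :: "'a measure" and MY :: "'b measure" and MW :: "'c measure"
    and Y :: "nat \<Rightarrow> 'a \<Rightarrow> real ^ 'p"
    and \<eta> W :: "nat \<Rightarrow> 'a \<Rightarrow> real ^ 'm"
    and \<epsilon> :: "'a \<Rightarrow> real ^ 'p"
    and \<Lambda> :: "real ^ 'm ^ 'p"
    and B :: "real ^ 'm ^ 'm"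
    and Q D Dstar :: "complex ^ 'm ^ 'm"
    and Ystar :: "'b \<Rightarrow> real ^ 'p"
    and Wstar :: "'c \<Rightarrow> real ^ 'm"
  assumes "prob_space M" and "prob_space MY" and "prob_space MW"
    and "\<And>t. Y t \<in> borel_measurable M"
    and "\<And>t. \<eta> t \<in> borel_measurable M"
    and "\<And>t. AE \<omega> in M. Y t \<omega> = \<Lambda> *v \<eta> t \<omega> + \<epsilon> \<omega>"
    and "prob_space.indep_vars M (\<lambda>_. borel) (\<lambda>i \<omega>. \<epsilon> \<omega> $ i) UNIV"
    and "\<And>i. prob_space.normal_rv M (\<lambda>\<omega>. \<epsilon> \<omega> $ i)"
    and "\<And>t. t \<ge> 1 \<Longrightarrow> AE \<omega> in M. \<eta> t \<omega> = B *v \<eta> (t - 1) \<omega> + W t \<omega>"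
    and "prob_space.indep_vars M (\<lambda>_. borel) W {1..}"
    and "\<And>t. t \<ge> 1 \<Longrightarrow> prob_space.normal_vector M (W t)"
    and "invertible Q" and "is_jordan_form D"
    and "(\<chi> i j. complex_of_real (B $ i $ j)) = Q ** D ** matrix_inv Q"
    and "(\<lambda>t. matpow D t) \<longlonglongrightarrow> Dstar"
    and "Ystar \<in> borel_measurable MY" and "conv_in_distribution M Y MY Ystar"
    and "invertible B"
    and "prob_space.normal_vector MW Wstar"
    and "conv_in_distribution M (\<lambda>t \<omega>. \<Sum>k=1..t. matpow (matrix_inv B) k *v W k \<omega>) MW Wstar"
  shows "follows_factor_model MY Ystar M \<epsilon> (rank Dstar)"
proof -
  interpret M: prob_space M by fact
  let ?X = "\<lambda>k \<omega>. matpow (matrix_inv B) k *v W k \<omega>"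
  note [measurable] = assms(4,5,16)
  have \<epsilon> [measurable]: "\<epsilon> \<in> borel_measurable M"
    using assms(8) distributed_measurable
    by (fastforce simp: borel_measurable_vec_iff M.normal_rv_def)
  have Xmeas: "?X k \<in> borel_measurable M" if "k \<ge> 1" for k
    using assms(11)[OF that] by (auto simp: M.normal_vector_def)
  have [measurable]: "(\<lambda>\<omega>. \<Sum>k=1..t. ?X k \<omega>) \<in> borel_measurable M" for t
    by (intro borel_measurable_sum Xmeas) auto
  have "M.indep_vars (\<lambda>_. borel) ?X {1..}"
    using assms(10) by (rule M.indep_vars_compose2) simp
  then obtain r where r: "strict_mono r"
      and conv: "AE \<omega> in M. convergent (\<lambda>n. \<Sum>k=1..r n. ?X k \<omega>)"
    using M.indep_sums_AE_convergent_subseq[OF _ assms(3,19,20)] by blast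
  obtain Bstar where Bstar: "(\<lambda>t. matpow B t) \<longlonglongrightarrow> Bstar" "rank Bstar \<le> rank Dstar"
    using matpow_limit_real[OF assms(12) _ assms(15)] assms(14) by (auto simp: complex_mat_def)
  obtain b c where bc: "\<And>x. Bstar *v x = (\<Sum>j<rank Dstar. (c j \<bullet> x) *\<^sub>R b j)"
    using rank_factorisation[OF Bstar(2)] by blast
  \<comment> \<open>\<open>lim\<close> is total: where the sums diverge its value is arbitrary, but
    this happens only on a null set.\<close>
  define S where "S \<omega> = \<eta> 0 \<omega> + lim (\<lambda>n. \<Sum>k=1..r n. ?X k \<omega>)" for \<omega>
  have [measurable]: "S \<in> borel_measurable M"
    unfolding S_def by measurable
  \<comment> \<open>There are countably many times, so one null set serves all of them and the
    recursion can be unfolded path by path.\<close>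
  have "AE \<omega> in M. \<forall>t. Y t \<omega> = \<Lambda> *v \<eta> t \<omega> + \<epsilon> \<omega>"
    using assms(6) by (simp add: AE_all_countable)
  moreover have "AE \<omega> in M. \<forall>t. t \<ge> 1 \<longrightarrow> \<eta> t \<omega> = B *v \<eta> (t - 1) \<omega> + W t \<omega>"
    using assms(9) by (subst AE_all_countable) (auto simp: AE_impI)
  ultimately have "AE \<omega> in M. (\<lambda>n. Y (r n) \<omega>) \<longlonglongrightarrow> \<Lambda> *v (Bstar *v S \<omega>) + \<epsilon> \<omega>"
    using conv
  proof eventually_elim
    case (elim \<omega>)
    have Y: "Y t \<omega> = \<Lambda> *v (matpow B t *v (\<eta> 0 \<omega> + (\<Sum>k=1..t. ?X k \<omega>))) + \<epsilon> \<omega>" for t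
      using elim(1) autoregression_unfold[OF assms(18), of "\<lambda>t. \<eta> t \<omega>" "\<lambda>t. W t \<omega>" t] elim(2) by simp
    have "(\<lambda>n. \<Sum>k=1..r n. ?X k \<omega>) \<longlonglongrightarrow> lim (\<lambda>n. \<Sum>k=1..r n. ?X k \<omega>)"
      using elim(3) by (simp add: convergent_LIMSEQ_iff)
    moreover have "(\<lambda>n. matpow B (r n)) \<longlonglongrightarrow> Bstar"
      using LIMSEQ_subseq_LIMSEQ[OF Bstar(1) r] by (simp add: comp_def)
    ultimately show ?case
      unfolding Y S_def by (intro tendsto_add tendsto_matrix_vector_mult tendsto_const)
  qed
  then have law: "distr MY borel Ystar = distr M borel (\<lambda>\<omega>. \<Lambda> *v (Bstar *v S \<omega>) + \<epsilon> \<omega>)"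
    by (intro conv_in_distribution_AE_subseq_limit[OF assms(1,2) _ _ _ assms(17) r]) measurable
  \<comment> \<open>The factorisation of \<open>Bstar\<close> supplies the loading columns
    \<open>\<Lambda> *v b j\<close> and the factors \<open>c j \<bullet> S \<omega>\<close>.\<close>
  have "\<Lambda> *v (Bstar *v x) = (\<chi> i. \<Sum>j<rank Dstar. (\<Lambda> *v b j) $ i * (c j \<bullet> x))" for x
    by (simp add: bc vec_eq_iff linear_sum[OF matrix_vector_mul_linear]
        linear_cmul[OF matrix_vector_mul_linear] mult.commute)
  then have "distr MY borel Ystar = distr M borel
      (\<lambda>\<omega>. (\<chi> i. \<Sum>j<rank Dstar. (\<Lambda> *v b j) $ i * (c j \<bullet> S \<omega>)) + \<epsilon> \<omega>)"
    by (simp only: law)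
  moreover have "(\<lambda>\<omega>. c j \<bullet> S \<omega>) \<in> borel_measurable M" for j
    by measurable
  ultimately show ?thesis
    unfolding follows_factor_model_def
    by (intro exI[of _ "\<lambda>i j. (\<Lambda> *v b j) $ i"] exI[of _ "\<lambda>j \<omega>. c j \<bullet> S \<omega>"] conjI allI impI)
qed

end
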